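(* Let $\Sigma$ be a finite nonempty set, let $\mu\in\mathbb{P}(\Sigma)$ be a fixed probability vector, let $\ell=(\ell_i)_{i\in\Sigma}$ be a vector of non-negative reals with $\ell_{\min}<\ell_{\max}$, and let $R\in[0,2]$. Let $$D^-(R)=\inf\Big\{\sum_{i\in\Sigma}\ell_i\nu_i:\ \nu\in\mathbb{P}(\Sigma),\ \sum_{i\in\Sigma}|\nu_i-\mu_i|\le R\Big\}.$$ Then the infimum is attained and $$D^-(R)=\ell_{\max}\,\nu^*(\Sigma^0)+\ell_{\min}\,\nu^*(\Sigma_0)+\sum_{k=1}^{r}\ell(\Sigma^k)\,\nu^*(\Sigma^k),$$ where the masses of the optimal (minimizing) probability vector $\nu^*$ are given by $$\nu^*(\Sigma_0)=\mu(\Sigma_0)+\alpha,$$ $$\nu^*(\Sigma^0)=\big(\mu(\Sigma^0)-\alpha\big)^+,$$ $$\nu^*(\Sigma^k)=\Big(\mu(\Sigma^k)-\Big(\alpha-\sum_{j=1}^{k}\mu(\Sigma^{j-1})\Big)^+\Big)^+,\qquad k=1,\dots,r,$$ $$\alpha=\min\Big(\frac{R}{2},\,1-\mu(\Sigma_0)\Big).$$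
   Context: $\mathbb{P}(\Sigma)$ is the set of probability vectors $p=(p_i)_{i\in\Sigma}$, $p_i\ge 0$, $\sum_{i}p_i=1$. For $p\in\mathbb{P}(\Sigma)$ and $A\subseteq\Sigma$, $p(A)=\sum_{i\in A}p_i$. For a real $x$, $x^+=\max(x,0)$. Set $\ell_{\max}=\max_{i\in\Sigma}\ell_i$, $\ell_{\min}=\min_{i\in\Sigma}\ell_i$, $\Sigma^0=\{i\in\Sigma:\ell_i=\ell_{\max}\}$, $\Sigma_0=\{i\in\Sigma:\ell_i=\ell_{\min}\}$. Recursively, for $k=1,2,\dots$, as long as $\Sigma\setminus(\Sigma_0\cup\Sigma^0\cup\dots\cup\Sigma^{k-1})$ is nonempty, let $\ell(\Sigma^k)=\max\{\ell_i: i\in\Sigma\setminus(\Sigma_0\cup\Sigma^0\cup\dots\cup\Sigma^{k-1})\}$ and $\Sigma^k=\{i\in\Sigma:\ell_i=\ell(\Sigma^k)\}$. Let $r$ be the number of sets $\Sigma^k$ ($k\ge 1$) so obtained, i.e. the number of distinct values of $\ell$ strictly between $\ell_{\min}$ and $\ell_{\max}$; if $r=0$ the sum over $k$ is empty. *)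

theory Defs
  imports Complex_Main
begin

text \<open>A vector indexed by the finite set \<open>S\<close> is a function of which only the values on \<open>S\<close> matter.\<close>

definition prob_vectors :: "'a set \<Rightarrow> ('a \<Rightarrow> real) set" where
  "prob_vectors S = {p. (\<forall>i\<in>S. 0 \<le> p i) \<and> (\<Sum>i\<in>S. p i) = 1}"

definition mass :: "('a \<Rightarrow> real) \<Rightarrow> 'a set \<Rightarrow> real" where
  "mass p A = (\<Sum>i\<in>A. p i)"

definition pos_part :: "real \<Rightarrow> real" where
  "pos_part x = max x 0"

definition tv_ball :: "'a set \<Rightarrow> ('a \<Rightarrow> real) \<Rightarrow> real \<Rightarrow> ('a \<Rightarrow> real) set" where
  "tv_ball S \<mu> R = {\<nu> \<in> prob_vectors S. (\<Sum>i\<in>S. \<bar>\<nu> i - \<mu> i\<bar>) \<le> R}"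

definition D_minus :: "'a set \<Rightarrow> ('a \<Rightarrow> real) \<Rightarrow> ('a \<Rightarrow> real) \<Rightarrow> real \<Rightarrow> real" where
  "D_minus S \<mu> l R = (INF \<nu>\<in>tv_ball S \<mu> R. \<Sum>i\<in>S. l i * \<nu> i)"

definition l_max :: "'a set \<Rightarrow> ('a \<Rightarrow> real) \<Rightarrow> real" where
  "l_max S l = Max (l ` S)"

definition l_min :: "'a set \<Rightarrow> ('a \<Rightarrow> real) \<Rightarrow> real" where
  "l_min S l = Min (l ` S)"

definition bottom_set :: "'a set \<Rightarrow> ('a \<Rightarrow> real) \<Rightarrow> 'a set" where
  "bottom_set S l = {i \<in> S. l i = l_min S l}"

text \<open>
  \<open>level_set S l k\<close> is \<open>\<Sigma>\<^sup>k\<close> (with \<open>\<Sigma>\<^sup>0\<close> the argmax set), and \<open>remaining S l k\<close> is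
  \<open>\<Sigma> - (\<Sigma>\<^sub>0 \<union> \<Sigma>\<^sup>0 \<union> \<dots> \<union> \<Sigma>\<^sup>k\<^sup>-\<^sup>1)\<close>. Where the recursion has stopped, i.e. nothing remains,
  \<open>level_set\<close> is set to \<open>{}\<close>, so that nothing remains from there on either.
\<close>

function (sequential)
  level_set :: "'a set \<Rightarrow> ('a \<Rightarrow> real) \<Rightarrow> nat \<Rightarrow> 'a set" and
  remaining :: "'a set \<Rightarrow> ('a \<Rightarrow> real) \<Rightarrow> nat \<Rightarrow> 'a set"
where
  "level_set S l 0 = {i \<in> S. l i = l_max S l}"
| "level_set S l (Suc k) =
     (if remaining S l (Suc k) = {} then {}
      else {i \<in> S. l i = Max (l ` remaining S l (Suc k))})"
| "remaining S l k = S - (bottom_set S l \<union> (\<Union>j\<in>{..<k}. level_set S l j))"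
  by pat_completeness auto
termination
  by (relation "measure (case_sum (\<lambda>(S, l, k). 2 * k + 1) (\<lambda>(S, l, k). 2 * k))") auto

text \<open>\<open>\<ell>(\<Sigma>\<^sup>k)\<close>, meaningful for \<open>1 \<le> k \<le> r\<close> only.\<close>

definition level_value :: "'a set \<Rightarrow> ('a \<Rightarrow> real) \<Rightarrow> nat \<Rightarrow> real" where
  "level_value S l k = Max (l ` remaining S l k)"

definition num_levels :: "'a set \<Rightarrow> ('a \<Rightarrow> real) \<Rightarrow> nat" where
  "num_levels S l = card {k. 1 \<le> k \<and> remaining S l k \<noteq> {}}"

end

theory Submission imports Defs begin

text \<open>
  For \<open>\<nu>\<close> in the ball and any \<open>A \<subseteq> S\<close> one has \<open>\<nu>(A) \<ge> (\<mu>(A) - R/2)\<^sup>+\<close>. By Abel summation the cost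
  is \<open>l_min\<close> plus a combination, with strictly positive coefficients, of the masses of the upper
  level sets \<open>{l \<ge> t}\<close>, \<open>t > l_min\<close>. Removing mass \<open>\<alpha>\<close> from the top down attains the lower bounds for
  all upper level sets simultaneously; hence a point of the ball is a minimizer iff it attains all
  of them, and the masses of the level sets are differences of those of upper level sets.
\<close>

section \<open>Summation over upper sets\<close>

text \<open>Elements are inserted in order of decreasing \<open>l\<close>, so each new
  \<open>x\<close> has the least value. The base \<open>c\<close> is arbitrary because the induction
  hypothesis is used at base \<open>l x\<close>. The equality clause is what later describes all
  minimizers rather than a single one.\<close>

lemma abel_summation_nonneg:
  fixes l d :: "'a \<Rightarrow> real"
  assumes "finite A"
    and "\<And>i. i \<in> A \<Longrightarrow> c \<le> l i"
    and "\<And>t. c < t \<Longrightarrow> 0 \<le> (\<Sum>i\<in>{i\<in>A. t \<le> l i}. d i)"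
  shows "0 \<le> (\<Sum>i\<in>A. (l i - c) * d i) \<and>
    ((\<Sum>i\<in>A. (l i - c) * d i) = 0 \<longrightarrow> (\<forall>t>c. (\<Sum>i\<in>{i\<in>A. t \<le> l i}. d i) = 0))"
  using assms
proof (induction A arbitrary: c rule: finite_ranking_induct[where f = "\<lambda>i. - l i"])
  case empty
  then show ?case by simp
next
  case (insert x A)
  show ?case
  \<comment> \<open>The induction rule allows \<open>x\<close> to lie in \<open>A\<close> already;
    then the insertion changes nothing.\<close>
  proof (cases "x \<in> A")
    case True
    show ?thesis
      unfolding insert_absorb[OF True]
      by (rule insert.IH) (use insert.prems in \<open>auto simp: insert_absorb[OF True]\<close>)
  next
    case False
    have min: "l x \<le> l y" if "y \<in> A" for y using insert.hyps(2)[OF that] by simp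
    have above: "{i \<in> insert x A. t \<le> l i} = {i \<in> A. t \<le> l i}" if "l x < t" for t
      using that by auto
    have all: "{i \<in> insert x A. t \<le> l i} = insert x A" if "t \<le> l x" for t
      using that min by force
    have cx: "c \<le> l x" using insert.prems by simp
    have nn: "0 \<le> (\<Sum>i\<in>{i \<in> A. t \<le> l i}. d i)" if "l x < t" for t
      using insert.prems(2)[of t] above[OF that] cx that by simp
    note IH = insert.IH[of "l x", OF min nn]
    \<comment> \<open>Lowering the base from \<open>l x\<close> to \<open>c\<close> adds
      \<open>l x - c\<close> to every coefficient; at base \<open>l x\<close> the element
      \<open>x\<close> itself has coefficient 0.\<close>
    have tot: "(\<Sum>i\<in>insert x A. (l i - c) * d i)
        = (\<Sum>i\<in>A. (l i - l x) * d i) + (l x - c) * (\<Sum>i\<in>insert x A. d i)"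
      using False insert.hyps(1)
      by (simp add: algebra_simps sum.distrib sum_subtractf sum_distrib_left)
    show ?thesis
    \<comment> \<open>Here no \<open>t > c\<close> has the whole set as its upper set, so the sign
      of the total of \<open>d\<close> is unknown, but its coefficient \<open>l x - c\<close>
      vanishes.\<close>
    proof (cases "c = l x")
      case True
      then show ?thesis using tot IH above by simp
    next
      case neq: False
      then have lt: "c < l x" using cx by simp
      have D: "0 \<le> (\<Sum>i\<in>insert x A. d i)"
        using insert.prems(2)[OF lt] all[of "l x"] by simp
      then have D': "0 \<le> (l x - c) * (\<Sum>i\<in>insert x A. d i)" using lt by simp
      have "(\<Sum>i\<in>{i \<in> insert x A. t \<le> l i}. d i) = 0"
        if z: "(\<Sum>i\<in>insert x A. (l i - c) * d i) = 0" and "c < t" for t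
      proof (cases "t \<le> l x")
        case True
        have "(l x - c) * (\<Sum>i\<in>insert x A. d i) = 0" using z tot IH D' by linarith
        then show ?thesis using all[OF True] lt by simp
      next
        case False
        have "(\<Sum>i\<in>A. (l i - l x) * d i) = 0" using z tot IH D' by linarith
        then show ?thesis using IH False above by simp
      qed
      then show ?thesis using tot IH D' by auto
    qed
  qed
qed

text \<open>One vector has to serve all thresholds at once. Adding elements by decreasing
  \<open>l\<close>, each receives the increment of s \<mapsto> (s - \<alpha>)^+ evaluated at the
  accumulated mass of \<open>\<mu>\<close>. This function is nondecreasing and 1-Lipschitz, so the
  increment lies between 0 and \<open>\<mu> x\<close>.\<close>

lemma exists_top_down_removal:
  fixes l \<mu> :: "'a \<Rightarrow> real"
  assumes "finite A" and "\<And>i. i \<in> A \<Longrightarrow> 0 \<le> \<mu> i" and "0 \<le> \<alpha>"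
  shows "\<exists>\<nu>. (\<forall>i\<in>A. 0 \<le> \<nu> i \<and> \<nu> i \<le> \<mu> i) \<and>
    (\<forall>t. mass \<nu> {i\<in>A. t \<le> l i} = pos_part (mass \<mu> {i\<in>A. t \<le> l i} - \<alpha>))"
  using assms(1,2)
proof (induction A rule: finite_ranking_induct[where f = "\<lambda>i. - l i"])
  case empty
  then show ?case using assms(3) by (simp add: mass_def pos_part_def)
next
  case (insert x A)
  show ?case
  proof (cases "x \<in> A")
    case True
    then show ?thesis using insert by (simp add: insert_absorb)
  next
    case False
    obtain \<nu> where \<nu>: "\<forall>i\<in>A. 0 \<le> \<nu> i \<and> \<nu> i \<le> \<mu> i"
      and m: "\<And>t. mass \<nu> {i\<in>A. t \<le> l i} = pos_part (mass \<mu> {i\<in>A. t \<le> l i} - \<alpha>)"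
      using insert.IH insert.prems by auto
    have min: "l x \<le> l y" if "y \<in> A" for y using insert.hyps(2)[OF that] by simp
    define \<nu>' where
      "\<nu>' = \<nu>(x := pos_part (mass \<mu> (insert x A) - \<alpha>) - pos_part (mass \<mu> A - \<alpha>))"
    have eq: "mass \<nu>' B = mass \<nu> B" if "B \<subseteq> A" for B
      unfolding mass_def \<nu>'_def using that False by (intro sum.cong) auto
    have "A = {i\<in>A. l x \<le> l i}" using min by auto
    then have mA: "mass \<nu> A = pos_part (mass \<mu> A - \<alpha>)" using m[of "l x"] by simp
    have ins: "mass p (insert x A) = p x + mass p A" for p :: "'a \<Rightarrow> real"
      using False insert.hyps(1) by (simp add: mass_def)
    have "0 \<le> \<mu> x" using insert.prems by simp
    then have "0 \<le> \<nu>' x \<and> \<nu>' x \<le> \<mu> x"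
      unfolding \<nu>'_def ins by (auto simp: pos_part_def)
    then have bounds: "\<forall>i\<in>insert x A. 0 \<le> \<nu>' i \<and> \<nu>' i \<le> \<mu> i"
      using \<nu> by (auto simp: \<nu>'_def)
    have "mass \<nu>' {i\<in>insert x A. t \<le> l i} = pos_part (mass \<mu> {i\<in>insert x A. t \<le> l i} - \<alpha>)" for t
    proof (cases "t \<le> l x")
      case True
      then have all: "{i \<in> insert x A. t \<le> l i} = insert x A" using min by force
      have "mass \<nu>' (insert x A) = \<nu>' x + mass \<nu> A" using ins eq[of A] by simp
      then show ?thesis unfolding all mA by (simp add: \<nu>'_def)
    next
      case False
      then have "{i \<in> insert x A. t \<le> l i} = {i \<in> A. t \<le> l i}" by auto
      then show ?thesis using eq[of "{i \<in> A. t \<le> l i}"] m by auto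
    qed
    then show ?thesis using bounds by blast
  qed
qed

section \<open>Lower bounds in the ball and their attainment\<close>

text \<open>Since both vectors have total 1, a deficit of \<open>\<nu>\<close> on \<open>A\<close>
  reappears as a surplus on \<open>S - A\<close>. It is thus counted twice in the distance and is at
  most \<open>R / 2\<close>.\<close>

lemma mass_ge_of_tv_ball:
  assumes "finite S" "\<mu> \<in> prob_vectors S" "\<nu> \<in> tv_ball S \<mu> R" "A \<subseteq> S"
  shows "pos_part (mass \<mu> A - R / 2) \<le> mass \<nu> A"
proof -
  have \<nu>: "\<forall>i\<in>S. 0 \<le> \<nu> i" "sum \<nu> S = 1" "(\<Sum>i\<in>S. \<bar>\<nu> i - \<mu> i\<bar>) \<le> R" "sum \<mu> S = 1"
    using assms(2,3) by (auto simp: tv_ball_def prob_vectors_def)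
  have sp: "sum f S = sum f (S - A) + sum f A" for f :: "'a \<Rightarrow> real"
    using sum.subset_diff[OF assms(4,1)] .
  have "mass \<mu> A - mass \<nu> A = - (\<Sum>i\<in>A. \<nu> i - \<mu> i)"
    by (simp add: mass_def sum_subtractf)
  also have "\<dots> \<le> (\<Sum>i\<in>A. \<bar>\<nu> i - \<mu> i\<bar>)"
    unfolding sum_negf[symmetric] by (intro sum_mono) auto
  finally have 1: "mass \<mu> A - mass \<nu> A \<le> (\<Sum>i\<in>A. \<bar>\<nu> i - \<mu> i\<bar>)" .
  have "mass \<mu> A - mass \<nu> A = (\<Sum>i\<in>S - A. \<nu> i - \<mu> i)"
    using \<nu> sp[of \<mu>] sp[of \<nu>] by (simp add: mass_def sum_subtractf)
  also have "\<dots> \<le> (\<Sum>i\<in>S - A. \<bar>\<nu> i - \<mu> i\<bar>)"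
    by (intro sum_mono) auto
  finally have "mass \<mu> A - mass \<nu> A \<le> (\<Sum>i\<in>S - A. \<bar>\<nu> i - \<mu> i\<bar>)" .
  then have "2 * (mass \<mu> A - mass \<nu> A) \<le> (\<Sum>i\<in>S - A. \<bar>\<nu> i - \<mu> i\<bar>) + (\<Sum>i\<in>A. \<bar>\<nu> i - \<mu> i\<bar>)"
    using 1 by simp
  also have "\<dots> \<le> R" using sp[of "\<lambda>i. \<bar>\<nu> i - \<mu> i\<bar>"] \<nu>(3) by simp
  finally have "2 * (mass \<mu> A - mass \<nu> A) \<le> R" .
  moreover have "0 \<le> mass \<nu> A"
    unfolding mass_def using \<nu>(1) assms(4) by (intro sum_nonneg) auto
  ultimately show ?thesis by (simp add: pos_part_def)
qed

lemma l_min_le: "finite S \<Longrightarrow> i \<in> S \<Longrightarrow> l_min S l \<le> l i"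
  by (simp add: l_min_def)

lemma le_l_max: "finite S \<Longrightarrow> i \<in> S \<Longrightarrow> l i \<le> l_max S l"
  by (simp add: l_max_def)

text \<open>An upper set above \<open>l_min\<close> misses the bottom set. This accounts for the
  second argument of the minimum in \<alpha>: when \<alpha> equals
  \<open>1 - mass \<mu> (bottom_set S l)\<close>, the mass prescribed for such an upper set is
  0.\<close>

lemma mass_upper_set_le:
  assumes "finite S" "\<mu> \<in> prob_vectors S" "l_min S l < t"
  shows "mass \<mu> {i\<in>S. t \<le> l i} \<le> 1 - mass \<mu> (bottom_set S l)"
proof -
  have "mass \<mu> {i\<in>S. t \<le> l i} + mass \<mu> (bottom_set S l)
      = mass \<mu> ({i\<in>S. t \<le> l i} \<union> bottom_set S l)"
    unfolding mass_def using assms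
    by (intro sum.union_disjoint[symmetric]) (auto simp: bottom_set_def)
  also have "\<dots> \<le> mass \<mu> S"
    unfolding mass_def using assms
    by (intro sum_mono2) (auto simp: bottom_set_def prob_vectors_def)
  also have "\<dots> = 1" using assms(2) by (simp add: mass_def prob_vectors_def)
  finally show ?thesis by simp
qed

text \<open>Mass \<alpha> is removed top down outside the bottom set and moved into it. The distance
  covered is 2\<alpha>, which is at most \<open>R\<close>.\<close>

lemma exists_tight_tv_ball:
  fixes l \<mu> :: "'a \<Rightarrow> real"
  defines "\<alpha> R S \<equiv> min (R / 2) (1 - mass \<mu> (bottom_set S l))"
  assumes "finite S" "S \<noteq> {}" "\<mu> \<in> prob_vectors S" "0 \<le> R"
  shows "\<exists>\<nu>\<in>tv_ball S \<mu> R. \<forall>t>l_min S l.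
    mass \<nu> {i\<in>S. t \<le> l i} = pos_part (mass \<mu> {i\<in>S. t \<le> l i} - \<alpha> R S)"
proof -
  let ?B = "bottom_set S l" and ?\<alpha> = "\<alpha> R S"
  let ?A = "S - ?B"
  have \<mu>: "\<forall>i\<in>S. 0 \<le> \<mu> i" "sum \<mu> S = 1" using assms by (auto simp: prob_vectors_def)
  have B: "?B \<subseteq> S" and fB: "finite ?B" using assms(2) by (auto simp: bottom_set_def)
  have sp: "sum f S = sum f ?A + sum f ?B" for f :: "'a \<Rightarrow> real"
    using sum.subset_diff[OF B assms(2)] .
  have \<mu>A: "mass \<mu> ?A = 1 - mass \<mu> ?B" using sp[of \<mu>] \<mu> by (simp add: mass_def)
  have "0 \<le> mass \<mu> ?A" unfolding mass_def using \<mu> by (intro sum_nonneg) auto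
  then have \<alpha>: "0 \<le> ?\<alpha>" "?\<alpha> \<le> mass \<mu> ?A" "2 * ?\<alpha> \<le> R"
    using \<mu>A assms(5) by (auto simp: \<alpha>_def min_def)
  have "l_min S l \<in> l ` S" unfolding l_min_def using assms by (intro Min_in) auto
  then obtain b where b: "b \<in> ?B" by (auto simp: bottom_set_def)
  obtain \<nu> where \<nu>: "\<forall>i\<in>?A. 0 \<le> \<nu> i \<and> \<nu> i \<le> \<mu> i"
    and m: "\<And>t. mass \<nu> {i\<in>?A. t \<le> l i} = pos_part (mass \<mu> {i\<in>?A. t \<le> l i} - ?\<alpha>)"
    using exists_top_down_removal[of ?A \<mu> ?\<alpha> l] assms \<mu> \<alpha> by auto
  \<comment> \<open>At this threshold the removal lemma speaks of all of \<open>?A\<close>; as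
    \<open>?\<alpha> \<le> mass \<mu> ?A\<close>, nothing is truncated and exactly
    \<open>?\<alpha>\<close> is removed.\<close>
  have "{i\<in>?A. l_min S l \<le> l i} = ?A" using l_min_le[OF assms(2)] by auto
  then have \<nu>A: "sum \<nu> ?A = sum \<mu> ?A - ?\<alpha>"
    using m[of "l_min S l"] \<alpha> by (simp add: mass_def pos_part_def)
  \<comment> \<open>How the removed mass is spread over the bottom set does not affect the cost, so
    the single point \<open>b\<close> takes all of it.\<close>
  define \<nu>' where "\<nu>' i = (if i \<in> ?B then \<mu> i + (if i = b then ?\<alpha> else 0) else \<nu> i)" for i
  have eqA: "sum \<nu>' C = sum \<nu> C" if "C \<subseteq> ?A" for C
    using that by (intro sum.cong) (auto simp: \<nu>'_def)
  have "sum \<nu>' ?B = (\<Sum>i\<in>?B. \<mu> i + (if i = b then ?\<alpha> else 0))"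
    by (intro sum.cong) (auto simp: \<nu>'_def)
  also have "\<dots> = sum \<mu> ?B + ?\<alpha>" using b fB by (simp add: sum.distrib)
  finally have "sum \<nu>' S = 1" using sp[of \<nu>'] sp[of \<mu>] eqA[of ?A] \<nu>A \<mu> by simp
  moreover have "\<forall>i\<in>S. 0 \<le> \<nu>' i" using \<mu> \<nu> \<alpha> by (auto simp: \<nu>'_def)
  moreover have "(\<Sum>i\<in>S. \<bar>\<nu>' i - \<mu> i\<bar>) \<le> R"
  proof -
    have "(\<Sum>i\<in>?B. \<bar>\<nu>' i - \<mu> i\<bar>) = (\<Sum>i\<in>?B. if i = b then ?\<alpha> else 0)"
      using \<alpha> by (intro sum.cong) (auto simp: \<nu>'_def)
    then have 1: "(\<Sum>i\<in>?B. \<bar>\<nu>' i - \<mu> i\<bar>) = ?\<alpha>" using b fB by simp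
    have "(\<Sum>i\<in>?A. \<bar>\<nu>' i - \<mu> i\<bar>) = (\<Sum>i\<in>?A. \<mu> i - \<nu> i)"
      using \<nu> by (intro sum.cong) (auto simp: \<nu>'_def)
    also have "\<dots> = ?\<alpha>" using \<nu>A by (simp add: sum_subtractf)
    finally show ?thesis using 1 sp[of "\<lambda>i. \<bar>\<nu>' i - \<mu> i\<bar>"] \<alpha>(3) by simp
  qed
  ultimately have "\<nu>' \<in> tv_ball S \<mu> R" by (simp add: tv_ball_def prob_vectors_def)
  moreover have "mass \<nu>' {i\<in>S. t \<le> l i} = pos_part (mass \<mu> {i\<in>S. t \<le> l i} - ?\<alpha>)"
    if "l_min S l < t" for t
  proof -
    have "{i\<in>S. t \<le> l i} = {i\<in>?A. t \<le> l i}" using that by (auto simp: bottom_set_def)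
    then show ?thesis using m[of t] eqA[of "{i\<in>?A. t \<le> l i}"] by (auto simp: mass_def)
  qed
  ultimately show ?thesis by blast
qed

text \<open>Any competitor is compared with a tight \<open>\<nu>0\<close> by Abel summation of their
  difference. Minimizers need not be unique, but the equality clause forces them all to share the
  upper masses of \<open>\<nu>0\<close>.\<close>

lemma tv_ball_minimizers:
  fixes l \<mu> :: "'a \<Rightarrow> real"
  defines "\<alpha> R S \<equiv> min (R / 2) (1 - mass \<mu> (bottom_set S l))"
  assumes "finite S" "S \<noteq> {}" "\<mu> \<in> prob_vectors S" "0 \<le> R"
  shows "\<exists>\<nu>\<in>tv_ball S \<mu> R. (\<Sum>i\<in>S. l i * \<nu> i) = D_minus S \<mu> l R"
    and "\<And>\<nu> t. \<nu> \<in> tv_ball S \<mu> R \<Longrightarrow> (\<Sum>i\<in>S. l i * \<nu> i) = D_minus S \<mu> l R \<Longrightarrow> l_min S l < t \<Longrightarrow>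
      mass \<nu> {i\<in>S. t \<le> l i} = pos_part (mass \<mu> {i\<in>S. t \<le> l i} - \<alpha> R S)"
proof -
  let ?c = "l_min S l"
  obtain \<nu>0 where \<nu>0: "\<nu>0 \<in> tv_ball S \<mu> R"
    and tight: "\<And>t. ?c < t \<Longrightarrow>
      mass \<nu>0 {i\<in>S. t \<le> l i} = pos_part (mass \<mu> {i\<in>S. t \<le> l i} - \<alpha> R S)"
    using exists_tight_tv_ball[OF assms(2-5), of l] by (auto simp: \<alpha>_def)
  have key: "(\<Sum>i\<in>S. l i * \<nu>0 i) \<le> (\<Sum>i\<in>S. l i * \<nu> i) \<and>
      ((\<Sum>i\<in>S. l i * \<nu> i) = (\<Sum>i\<in>S. l i * \<nu>0 i) \<longrightarrow>
        (\<forall>t>?c. mass \<nu> {i\<in>S. t \<le> l i} = mass \<nu>0 {i\<in>S. t \<le> l i}))"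
    if \<nu>: "\<nu> \<in> tv_ball S \<mu> R" for \<nu>
  proof -
    have diff: "(\<Sum>i\<in>C. \<nu> i - \<nu>0 i) = mass \<nu> C - mass \<nu>0 C" for C
      by (simp add: mass_def sum_subtractf)
    have "sum \<nu> S = 1" "sum \<nu>0 S = 1"
      using \<nu> \<nu>0 by (auto simp: tv_ball_def prob_vectors_def)
    \<comment> \<open>Equal totals allow \<open>?c\<close> to be subtracted from all coefficients
      without changing the difference of costs.\<close>
    then have cost: "(\<Sum>i\<in>S. (l i - ?c) * (\<nu> i - \<nu>0 i)) = (\<Sum>i\<in>S. l i * \<nu> i) - (\<Sum>i\<in>S. l i * \<nu>0 i)"
      by (simp add: algebra_simps sum.distrib sum_subtractf flip: sum_distrib_left sum_distrib_right)
    have "0 \<le> mass \<nu> {i\<in>S. t \<le> l i} - mass \<nu>0 {i\<in>S. t \<le> l i}" if t: "?c < t" for t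
    proof -
      have "pos_part (mass \<mu> {i\<in>S. t \<le> l i} - R / 2) \<le> mass \<nu> {i\<in>S. t \<le> l i}"
        by (rule mass_ge_of_tv_ball[OF assms(2,4) \<nu>]) auto
      moreover have "mass \<mu> {i\<in>S. t \<le> l i} \<le> 1 - mass \<mu> (bottom_set S l)"
        by (rule mass_upper_set_le[OF assms(2,4) t])
      \<comment> \<open>If \<alpha> is \<open>R / 2\<close>, the first bound is the claim; otherwise
        the second bound makes the tight mass 0.\<close>
      ultimately show ?thesis unfolding tight[OF t] \<alpha>_def by (simp add: pos_part_def min_def)
    qed
    then show ?thesis
      using abel_summation_nonneg[of S ?c l "\<lambda>i. \<nu> i - \<nu>0 i", OF assms(2) l_min_le[OF assms(2)]]
      unfolding diff cost by simp
  qed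
  have D: "D_minus S \<mu> l R = (\<Sum>i\<in>S. l i * \<nu>0 i)"
    unfolding D_minus_def using key \<nu>0 by (intro cInf_eq_minimum) auto
  then show "\<exists>\<nu>\<in>tv_ball S \<mu> R. (\<Sum>i\<in>S. l i * \<nu> i) = D_minus S \<mu> l R" using \<nu>0 by auto
  show "mass \<nu> {i\<in>S. t \<le> l i} = pos_part (mass \<mu> {i\<in>S. t \<le> l i} - \<alpha> R S)"
    if "\<nu> \<in> tv_ball S \<mu> R" "(\<Sum>i\<in>S. l i * \<nu> i) = D_minus S \<mu> l R" "?c < t" for \<nu> t
    using key[OF that(1)] that D tight by auto
qed

section \<open>The recursion for the level sets\<close>

text \<open>Unlike the set subtracted in \<open>remaining\<close>, this union leaves out the bottom
  set, so that it is an upper set of \<open>l\<close>, to which the tight masses apply.\<close>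

definition upper_levels :: "'a set \<Rightarrow> ('a \<Rightarrow> real) \<Rightarrow> nat \<Rightarrow> 'a set" where
  "upper_levels S l k = (\<Union>j<k. level_set S l j)"

lemma upper_levels_Suc: "upper_levels S l (Suc k) = upper_levels S l k \<union> level_set S l k"
  by (auto simp: upper_levels_def lessThan_Suc)

lemma remaining_eq: "remaining S l k = S - (bottom_set S l \<union> upper_levels S l k)"
  by (simp add: upper_levels_def)

declare level_set.simps(2) [simp del] remaining.simps [simp del]

text \<open>One step of the recursion. A level set is cut out of \<open>S\<close>, not out of
  \<open>remaining\<close>; the hypothesis \<open>up\<close> ensures that no element of value
  \<open>m\<close> was taken earlier, so that the sets taken so far are exactly those above
  \<open>m\<close>.\<close>

lemma level_set_Suc:
  assumes "finite S" "remaining S l (Suc k) \<noteq> {}"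
    and up: "\<exists>t. upper_levels S l (Suc k) = {i\<in>S. t \<le> l i}"
  defines "m \<equiv> level_value S l (Suc k)"
  shows "level_set S l (Suc k) = {i\<in>S. l i = m}"
    and "upper_levels S l (Suc k) = {i\<in>S. m < l i}"
    and "l_min S l < m"
    and "upper_levels S l (Suc (Suc k)) = {i\<in>S. m \<le> l i}"
    and "level_set S l (Suc k) \<noteq> {}"
proof -
  let ?Q = "remaining S l (Suc k)"
  obtain t where t: "upper_levels S l (Suc k) = {i\<in>S. t \<le> l i}" using up by blast
  have fin: "finite ?Q" using assms(1) by (simp add: remaining_eq)
  show L: "level_set S l (Suc k) = {i\<in>S. l i = m}"
    using assms(2) by (simp add: level_set.simps(2) m_def level_value_def)
  have "m \<in> l ` ?Q" unfolding m_def level_value_def using fin assms(2) by (intro Max_in) auto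
  then obtain q where q: "q \<in> ?Q" "l q = m" by auto
  then have q': "q \<in> S" "q \<notin> bottom_set S l" "m < t" by (auto simp: remaining_eq t)
  then show lm: "l_min S l < m"
    using q(2) l_min_le[OF assms(1), of q l] by (auto simp: bottom_set_def less_le)
  have "l i \<le> m" if "i \<in> ?Q" for i unfolding m_def level_value_def using fin that by simp
  then show U: "upper_levels S l (Suc k) = {i\<in>S. m < l i}"
    using q' lm by (force simp: t remaining_eq bottom_set_def)
  show "upper_levels S l (Suc (Suc k)) = {i\<in>S. m \<le> l i}"
    unfolding upper_levels_Suc[of S l "Suc k"] U L by auto
  show "level_set S l (Suc k) \<noteq> {}" using L q q' by auto
qed

text \<open>Thresholds strictly above \<open>l_min\<close> are those for which tightness is known.
  Once the recursion has stopped, \<open>level_set\<close> is \<open>{}\<close> and the previous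
  threshold persists, so \<open>k\<close> needs no bound.\<close>

lemma upper_levels_eq_upper_set:
  assumes "finite S" "l_min S l < l_max S l"
  shows "\<exists>t>l_min S l. upper_levels S l (Suc k) = {i\<in>S. t \<le> l i}"
proof (induction k)
  case 0
  have "upper_levels S l (Suc 0) = {i\<in>S. l_max S l \<le> l i}"
    using le_l_max[OF assms(1), of _ l] by (auto simp: upper_levels_def intro: antisym)
  then show ?case using assms(2) by blast
next
  case (Suc k)
  show ?case
  proof (cases "remaining S l (Suc k) = {}")
    case True
    then show ?thesis using Suc upper_levels_Suc[of S l "Suc k"] by (simp add: level_set.simps(2))
  next
    case False
    then show ?thesis using level_set_Suc(3,4)[OF assms(1) False] Suc by blast
  qed
qed

lemma upper_levels_disjoint_level_set:
  assumes "finite S" "l_min S l < l_max S l"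
  shows "upper_levels S l k \<inter> level_set S l k = {}"
proof (cases k)
  case 0
  then show ?thesis by (simp add: upper_levels_def)
next
  case (Suc j)
  show ?thesis
  proof (cases "remaining S l (Suc j) = {}")
    case True
    then show ?thesis using Suc by (simp add: level_set.simps(2))
  next
    case False
    have "\<exists>t. upper_levels S l (Suc j) = {i\<in>S. t \<le> l i}"
      using upper_levels_eq_upper_set[OF assms, of j] by blast
    from level_set_Suc(1,2)[OF assms(1) False this] show ?thesis unfolding Suc by auto
  qed
qed

lemma sum_upper_levels:
  assumes "finite S" "l_min S l < l_max S l"
  shows "sum f (upper_levels S l k) = (\<Sum>j<k. sum f (level_set S l j))"
proof (induction k)
  case 0
  then show ?case by (simp add: upper_levels_def)
next
  case (Suc k)
  have sub: "upper_levels S l (Suc k) \<subseteq> S"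
    using upper_levels_eq_upper_set[OF assms, of k] by auto
  then have "finite (upper_levels S l k)" "finite (level_set S l k)"
    using assms(1) finite_subset by (auto simp: upper_levels_Suc)
  then show ?case
    unfolding upper_levels_Suc
    by (simp add: sum.union_disjoint[OF _ _ upper_levels_disjoint_level_set[OF assms]] Suc)
qed

text \<open>Turns the cardinality \<open>num_levels\<close> into the index of the last level. The
  indices form an initial segment because \<open>remaining\<close> decreases, and a finite one
  because each level adds an element to the union.\<close>

lemma remaining_nonempty_iff:
  assumes "finite S" "l_min S l < l_max S l"
  shows "{k. 1 \<le> k \<and> remaining S l k \<noteq> {}} = {1..num_levels S l}"
proof -
  let ?K = "{k. 1 \<le> k \<and> remaining S l k \<noteq> {}}"
  have mono: "remaining S l j \<subseteq> remaining S l k" if "k \<le> j" for j k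
    using that by (fastforce simp: remaining.simps)
  have bound: "k \<le> card (upper_levels S l (Suc k))" if "remaining S l k \<noteq> {}" for k
    using that
  proof (induction k)
    case 0
    then show ?case by simp
  next
    case (Suc k)
    then have k: "k \<le> card (upper_levels S l (Suc k))" using mono[of k "Suc k"] by auto
    have "level_set S l (Suc k) \<noteq> {}"
      using level_set_Suc(5)[OF assms(1) Suc.prems] upper_levels_eq_upper_set[OF assms, of k]
      by auto
    then have "upper_levels S l (Suc k) \<subset> upper_levels S l (Suc (Suc k))"
      using upper_levels_disjoint_level_set[OF assms, of "Suc k"]
      unfolding upper_levels_Suc[of S l "Suc k"] by blast
    moreover have "finite (upper_levels S l (Suc (Suc k)))"
      using upper_levels_eq_upper_set[OF assms, of "Suc k"] assms(1) by auto
    ultimately have "card (upper_levels S l (Suc k)) < card (upper_levels S l (Suc (Suc k)))"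
      by (simp add: psubset_card_mono)
    then show ?case using k by simp
  qed
  have "k \<le> card S" if "k \<in> ?K" for k
  proof -
    have "upper_levels S l (Suc k) \<subseteq> S" using upper_levels_eq_upper_set[OF assms, of k] by auto
    then have "card (upper_levels S l (Suc k)) \<le> card S" by (rule card_mono[OF assms(1)])
    then show ?thesis using bound[of k] that by auto
  qed
  then have fin: "finite ?K" by (meson finite_nat_set_iff_bounded_le)
  have "?K = {1..card ?K}"
  proof (cases "?K = {}")
    case True
    then show ?thesis by (metis atLeastatMost_empty card.empty zero_less_one)
  next
    case False
    have "remaining S l (Max ?K) \<noteq> {}" using Max_in[OF fin False] by blast
    then have "k \<in> ?K" if "k \<in> {1..Max ?K}" for k using that mono[of k "Max ?K"] by auto
    moreover have "k \<in> {1..Max ?K}" if "k \<in> ?K" for k using that Max_ge[OF fin that] by simp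
    ultimately have "?K = {1..Max ?K}" by blast
    \<comment> \<open>An interval from 1 to M has M elements, so its maximum is its
      cardinality.\<close>
    then show ?thesis by (metis card_atLeastAtMost diff_Suc_1)
  qed
  then show ?thesis by (simp add: num_levels_def)
qed

section \<open>Masses of single levels from those of upper sets\<close>

theorem mainTheorem3:
  fixes S :: "'a set" and \<mu> l :: "'a \<Rightarrow> real" and R \<alpha> :: real and r :: nat
  assumes "finite S" and "S \<noteq> {}"
    and "\<mu> \<in> prob_vectors S"
    and "\<And>i. i \<in> S \<Longrightarrow> 0 \<le> l i"
    and "l_min S l < l_max S l"
    and "0 \<le> R" and "R \<le> 2"
  defines "\<alpha> \<equiv> min (R / 2) (1 - mass \<mu> (bottom_set S l))"
    and "r \<equiv> num_levels S l"
  shows "(\<exists>\<nu>\<in>tv_ball S \<mu> R. (\<Sum>i\<in>S. l i * \<nu> i) = D_minus S \<mu> l R) \<and>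
    (\<forall>\<nu>\<in>tv_ball S \<mu> R. (\<Sum>i\<in>S. l i * \<nu> i) = D_minus S \<mu> l R \<longrightarrow>
       D_minus S \<mu> l R =
         l_max S l * mass \<nu> (level_set S l 0) + l_min S l * mass \<nu> (bottom_set S l)
           + (\<Sum>k=1..r. level_value S l k * mass \<nu> (level_set S l k)) \<and>
       mass \<nu> (bottom_set S l) = mass \<mu> (bottom_set S l) + \<alpha> \<and>
       mass \<nu> (level_set S l 0) = pos_part (mass \<mu> (level_set S l 0) - \<alpha>) \<and>
       (\<forall>k\<in>{1..r}. mass \<nu> (level_set S l k) =
          pos_part (mass \<mu> (level_set S l k)
            - pos_part (\<alpha> - (\<Sum>j=1..k. mass \<mu> (level_set S l (j - 1)))))))"
proof -
  note basic = assms(1,2,3,6)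
  let ?U = "upper_levels S l" and ?L = "level_set S l" and ?B = "bottom_set S l"
  have R: "remaining S l k \<noteq> {} \<longleftrightarrow> k \<le> r" if "1 \<le> k" for k
  proof -
    have "k \<in> {k. 1 \<le> k \<and> remaining S l k \<noteq> {}} \<longleftrightarrow> k \<in> {1..r}"
      unfolding remaining_nonempty_iff[OF assms(1,5)] r_def ..
    then show ?thesis using that by simp
  qed
  obtain t where t: "l_min S l < t" "?U (Suc r) = {i\<in>S. t \<le> l i}"
    using upper_levels_eq_upper_set[OF assms(1,5)] by blast
  \<comment> \<open>Nothing remains at index \<open>Suc r\<close>, so levels 0 to \<open>r\<close>
    cover everything outside the bottom set; the threshold above \<open>l_min\<close> keeps them
    disjoint from it.\<close>
  have rest: "?B = S - ?U (Suc r)"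
    using R[of "Suc r"] t by (auto simp: remaining_eq bottom_set_def)
  have US: "?U (Suc r) \<subseteq> S" using t by auto
  have split: "sum f S = (\<Sum>j\<le>r. sum f (?L j)) + sum f ?B" for f :: "'a \<Rightarrow> real"
    using sum.subset_diff[OF US assms(1), of f] sum_upper_levels[OF assms(1,5), of f "Suc r"]
    by (simp add: rest lessThan_Suc_atMost)
  have massU: "mass p (?U k) = (\<Sum>j<k. mass p (?L j))" for p k
    using sum_upper_levels[OF assms(1,5)] by (simp add: mass_def)
  have total: "mass p (?U (Suc r)) = 1 - mass p ?B" if "p \<in> prob_vectors S" for p
    using that split[of p] massU[of p "Suc r"]
    by (simp add: prob_vectors_def mass_def lessThan_Suc_atMost)
  have \<alpha>0: "0 \<le> \<alpha>"
  proof -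
    have "0 \<le> mass \<mu> (?U (Suc r))"
      unfolding mass_def using assms(3) US by (intro sum_nonneg) (auto simp: prob_vectors_def)
    then show ?thesis using total[OF assms(3)] assms(6) by (simp add: \<alpha>_def)
  qed
  have "D_minus S \<mu> l R =
         l_max S l * mass \<nu> (?L 0) + l_min S l * mass \<nu> ?B
           + (\<Sum>k=1..r. level_value S l k * mass \<nu> (?L k)) \<and>
       mass \<nu> ?B = mass \<mu> ?B + \<alpha> \<and>
       mass \<nu> (?L 0) = pos_part (mass \<mu> (?L 0) - \<alpha>) \<and>
       (\<forall>k\<in>{1..r}. mass \<nu> (?L k) =
          pos_part (mass \<mu> (?L k) - pos_part (\<alpha> - (\<Sum>j=1..k. mass \<mu> (?L (j - 1))))))"
    if \<nu>: "\<nu> \<in> tv_ball S \<mu> R" and opt: "(\<Sum>i\<in>S. l i * \<nu> i) = D_minus S \<mu> l R" for \<nu>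
  proof (intro conjI ballI)
    have \<nu>P: "\<nu> \<in> prob_vectors S" using \<nu> by (simp add: tv_ball_def)
    have tight: "mass \<nu> (?U (Suc k)) = pos_part (mass \<mu> (?U (Suc k)) - \<alpha>)" for k
    proof -
      obtain s where "l_min S l < s" "?U (Suc k) = {i\<in>S. s \<le> l i}"
        using upper_levels_eq_upper_set[OF assms(1,5)] by blast
      then show ?thesis using tv_ball_minimizers(2)[OF basic \<nu> opt] by (simp add: \<alpha>_def)
    qed
    have const: "(\<Sum>i\<in>A. l i * \<nu> i) = v * mass \<nu> A" if "\<And>i. i \<in> A \<Longrightarrow> l i = v" for A v
      using that by (simp add: mass_def sum_distrib_left)
    have "(\<Sum>i\<in>?L k. l i * \<nu> i) = level_value S l k * mass \<nu> (?L k)" if k: "k \<in> {1..r}" for k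
    proof -
      obtain j where j: "k = Suc j" using k by (cases k) auto
      then have "remaining S l (Suc j) \<noteq> {}" using R[of k] k by simp
      from level_set_Suc(1)[OF assms(1) this] show ?thesis
        using upper_levels_eq_upper_set[OF assms(1,5), of j] j by (intro const) auto
    qed
    moreover have "(\<Sum>i\<in>?L 0. l i * \<nu> i) = l_max S l * mass \<nu> (?L 0)" by (intro const) auto
    moreover have "(\<Sum>i\<in>?B. l i * \<nu> i) = l_min S l * mass \<nu> ?B"
      by (intro const) (auto simp: bottom_set_def)
    moreover have "(\<Sum>j\<le>r. g j) = g 0 + (\<Sum>j=1..r. g j)" for g :: "nat \<Rightarrow> real"
      by (simp add: atMost_atLeast0 sum.atLeast_Suc_atMost)
    ultimately show "D_minus S \<mu> l R = l_max S l * mass \<nu> (?L 0) + l_min S l * mass \<nu> ?B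
           + (\<Sum>k=1..r. level_value S l k * mass \<nu> (?L k))"
      using split[of "\<lambda>i. l i * \<nu> i"] opt by simp
    \<comment> \<open>The union of all levels has \<open>\<mu>\<close>-mass
      \<open>1 - mass \<mu> ?B\<close>, which is at least \<alpha>, so its tight mass is not
      truncated.\<close>
    show "mass \<nu> ?B = mass \<mu> ?B + \<alpha>"
      using tight[of r] total[OF \<nu>P] total[OF assms(3)] by (simp add: \<alpha>_def pos_part_def)
    show "mass \<nu> (?L 0) = pos_part (mass \<mu> (?L 0) - \<alpha>)"
      using tight[of 0] by (simp add: massU)
    fix k assume k: "k \<in> {1..r}"
    then obtain j where j: "k = Suc j" by (cases k) auto
    have "(\<Sum>j=1..k. mass \<mu> (?L (j - 1))) = mass \<mu> (?U k)"
      unfolding massU by (simp add: sum.atLeast1_atMost_eq)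
    moreover have "mass p (?U (Suc k)) = mass p (?U k) + mass p (?L k)" for p
      by (simp add: massU)
    moreover have "?L k \<subseteq> S"
      using upper_levels_eq_upper_set[OF assms(1,5), of k] upper_levels_Suc[of S l k] by auto
    then have "0 \<le> mass \<mu> (?L k)"
      unfolding mass_def using assms(3) by (intro sum_nonneg) (auto simp: prob_vectors_def)
    \<comment> \<open>With u the \<open>\<mu>\<close>-mass of \<open>?U k\<close> and m \<ge> 0 that
      of \<open>?L k\<close>, this is (u + m - \<alpha>)^+ - (u - \<alpha>)^+ = (m - (\<alpha> -
      u)^+)^+. Tightness is stated at successors, hence the use of \<open>j\<close> for
      \<open>?U k\<close>.\<close>
    ultimately show "mass \<nu> (?L k) =
          pos_part (mass \<mu> (?L k) - pos_part (\<alpha> - (\<Sum>j=1..k. mass \<mu> (?L (j - 1)))))"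
      using tight[of k] tight[of j] \<alpha>0 unfolding j by (auto simp: pos_part_def max_def split: if_splits)
  qed
  then show ?thesis using tv_ball_minimizers(1)[OF basic] by blast
qed

end
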